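(* Let $X$ be a compact Hausdorff space and $A$ a commutative Banach algebra. If $A$ is weakly amenable and if $A$ has a bounded approximate identity, then $C(X,A)$ is weakly amenable.
   Context: Banach algebras are complex. $C(X,A)$ denotes the Banach algebra of all continuous functions $f: X\to A$ with pointwise algebraic operations and norm $\|f\|_\infty=\sup\{\|f(x)\|_A : x\in X\}$. A Banach algebra $B$ is weakly amenable if every continuous derivation from $B$ into its dual bimodule $B^*$ is inner. *)

theory Defs
  imports "HOL-Analysis.Analysis"
begin

section \<open>Complex Banach algebras\<close>

text \<open>The library has normed algebras over the reals only. A complex Banach algebra (not assumed to be
  unital or commutative) is a real one whose scalar multiplication extends to the complex field.\<close>

class complex_banach_algebra = real_normed_algebra + banach +
  fixes scaleC :: "complex \<Rightarrow> 'a \<Rightarrow> 'a" (infixr "*\<^sub>C" 75)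
  assumes scaleC_add_right: "c *\<^sub>C (x + y) = c *\<^sub>C x + c *\<^sub>C y"
    and scaleC_add_left: "(c + d) *\<^sub>C x = c *\<^sub>C x + d *\<^sub>C x"
    and scaleC_scaleC: "c *\<^sub>C d *\<^sub>C x = (c * d) *\<^sub>C x"
    and scaleC_of_real: "complex_of_real r *\<^sub>C x = r *\<^sub>R x"
    and norm_scaleC: "norm (c *\<^sub>C x) = cmod c * norm x"
    and mult_scaleC_left: "(c *\<^sub>C x) * y = c *\<^sub>C (x * y)"
    and mult_scaleC_right: "x * (c *\<^sub>C y) = c *\<^sub>C (x * y)"

lemma bounded_linear_scaleC: "bounded_linear (\<lambda>x :: 'a :: complex_banach_algebra. c *\<^sub>C x)"
proof (rule bounded_linear_intro)
  fix x y :: 'a and r :: real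
  show "c *\<^sub>C (x + y) = c *\<^sub>C x + c *\<^sub>C y" by (rule scaleC_add_right)
  show "c *\<^sub>C (r *\<^sub>R x) = r *\<^sub>R (c *\<^sub>C x)"
    by (simp only: scaleC_of_real[symmetric] scaleC_scaleC mult.commute)
  show "norm (c *\<^sub>C x) \<le> norm x * cmod c" by (simp add: norm_scaleC)
qed


section \<open>The Banach algebra of continuous functions\<close>

text \<open>On a compact space all continuous functions are bounded, so $C(X,A)$ is the type
  \<open>'x \<Rightarrow>\<^sub>C 'a\<close>, which the library already equips with the pointwise vector space structure
  and the supremum norm; see \<open>bcontfun_compact\<close> and \<open>norm_bcontfun_Sup\<close> below. The library states
  completeness for metric domains only, although metrizability plays no role.\<close>

unbundle bcontfun.lifting

instance bcontfun :: (topological_space, complete_space) complete_space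
proof
  fix f :: "nat \<Rightarrow> ('a, 'b) bcontfun"
  assume "Cauchy f"
  then obtain g where "uniform_limit UNIV f g sequentially"
    using uniformly_convergent_eq_cauchy[of "\<lambda>_. True" f]
    unfolding Cauchy_def uniform_limit_sequentially_iff
    by (metis dist_fun_lt_imp_dist_val_lt)
  from uniform_limit_bcontfunE[OF this sequentially_bot]
  obtain l where "f \<longlonglongrightarrow> l" by metis
  then show "convergent f" by (rule convergentI)
qed

instance bcontfun :: (topological_space, banach) banach ..

instantiation bcontfun :: (topological_space, real_normed_algebra) real_normed_algebra
begin

lift_definition times_bcontfun :: "('a \<Rightarrow>\<^sub>C 'b) \<Rightarrow> ('a \<Rightarrow>\<^sub>C 'b) \<Rightarrow> 'a \<Rightarrow>\<^sub>C 'b"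
  is "\<lambda>f g x. f x * g x"
proof -
  fix f g :: "'a \<Rightarrow> 'b"
  assume f: "f \<in> bcontfun" and g: "g \<in> bcontfun"
  obtain K L where K: "\<And>x. norm (f x) \<le> K" and L: "\<And>x. norm (g x) \<le> L"
    using f g unfolding bcontfun_def bounded_iff by auto
  show "(\<lambda>x. f x * g x) \<in> bcontfun"
  proof (rule bcontfun_normI)
    show "continuous_on UNIV (\<lambda>x. f x * g x)"
      using f g by (auto simp: bcontfun_def intro!: continuous_intros)
    show "norm (f x * g x) \<le> K * L" for x
      using norm_mult_ineq[of "f x" "g x"] mult_mono[OF K[of x] L[of x]] norm_ge_zero
      by (smt (verit) K)
  qed
qed

instance
proof
  fix f g h :: "'a \<Rightarrow>\<^sub>C 'b" and r :: real
  note [simp] = times_bcontfun.rep_eq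
  show "f * g * h = f * (g * h)" "(f + g) * h = f * h + g * h" "f * (g + h) = f * g + f * h"
    "(r *\<^sub>R f) * g = r *\<^sub>R (f * g)" "f * (r *\<^sub>R g) = r *\<^sub>R (f * g)"
    by (auto intro!: bcontfun_eqI simp: algebra_simps)
  show "norm (f * g) \<le> norm f * norm g"
  proof (rule norm_bound)
    fix x
    have "norm (f x * g x) \<le> norm (f x) * norm (g x)" by (rule norm_mult_ineq)
    also have "\<dots> \<le> norm f * norm g"
      by (intro mult_mono norm_bounded norm_ge_zero)
    finally show "norm ((f * g) x) \<le> norm f * norm g" by simp
  qed
qed

end

instance bcontfun :: (topological_space, "{real_normed_algebra, comm_ring}") comm_ring
proof
  fix f g h :: "'a \<Rightarrow>\<^sub>C 'b"
  show "f * g = g * f" "(f + g) * h = f * h + g * h"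
    by (auto intro!: bcontfun_eqI simp: times_bcontfun.rep_eq algebra_simps)
qed

instantiation bcontfun :: (topological_space, complex_banach_algebra) complex_banach_algebra
begin

lift_definition scaleC_bcontfun :: "complex \<Rightarrow> ('a \<Rightarrow>\<^sub>C 'b) \<Rightarrow> 'a \<Rightarrow>\<^sub>C 'b"
  is "\<lambda>c f x. c *\<^sub>C f x"
proof -
  fix c and f :: "'a \<Rightarrow> 'b"
  assume f: "f \<in> bcontfun"
  then obtain K where K: "\<And>x. norm (f x) \<le> K"
    unfolding bcontfun_def bounded_iff by auto
  show "(\<lambda>x. c *\<^sub>C f x) \<in> bcontfun"
  proof (rule bcontfun_normI)
    show "continuous_on UNIV (\<lambda>x. c *\<^sub>C f x)"
      using f by (auto simp: bcontfun_def intro: bounded_linear.continuous_on[OF bounded_linear_scaleC])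
    show "norm (c *\<^sub>C f x) \<le> cmod c * K" for x
      by (simp add: norm_scaleC mult_left_mono K)
  qed
qed

instance
proof
  fix f g :: "'a \<Rightarrow>\<^sub>C 'b" and c d :: complex and r :: real
  note [simp] = times_bcontfun.rep_eq scaleC_bcontfun.rep_eq
  show "c *\<^sub>C (f + g) = c *\<^sub>C f + c *\<^sub>C g" "(c + d) *\<^sub>C f = c *\<^sub>C f + d *\<^sub>C f"
    "c *\<^sub>C d *\<^sub>C f = (c * d) *\<^sub>C f" "complex_of_real r *\<^sub>C f = r *\<^sub>R f"
    "(c *\<^sub>C f) * g = c *\<^sub>C (f * g)" "f * (c *\<^sub>C g) = c *\<^sub>C (f * g)"
    by (auto intro!: bcontfun_eqI simp: scaleC_add_right scaleC_add_left scaleC_scaleC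
        scaleC_of_real mult_scaleC_left mult_scaleC_right)
  have le: "norm (e *\<^sub>C h) \<le> cmod e * norm h" for e and h :: "'a \<Rightarrow>\<^sub>C 'b"
    by (rule norm_bound) (simp add: norm_scaleC mult_left_mono norm_bounded)
  show "norm (c *\<^sub>C f) = cmod c * norm f"
  proof (cases "c = 0")
    case True
    then show ?thesis using le[of 0 f] by simp
  next
    case False
    have "(1 / c) *\<^sub>C c *\<^sub>C f = f"
      using False by (intro bcontfun_eqI)
        (use scaleC_of_real[of 1] in \<open>simp add: scaleC_scaleC\<close>)
    then have "norm f \<le> norm (c *\<^sub>C f) / cmod c"
      using le[of "1 / c" "c *\<^sub>C f"] by (simp add: norm_divide)
    then have "cmod c * norm f \<le> norm (c *\<^sub>C f)"
      using False by (simp add: field_simps)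
    then show ?thesis using le[of c f] by simp
  qed
qed

end

lemma bcontfun_compact:
  assumes "compact (UNIV :: 'x :: topological_space set)"
  shows "range (apply_bcontfun :: ('x \<Rightarrow>\<^sub>C 'a :: metric_space) \<Rightarrow> 'x \<Rightarrow> 'a) = {f. continuous_on UNIV f}"
proof -
  have "bounded (range f)" if "continuous_on UNIV f" for f :: "'x \<Rightarrow> 'a"
    using compact_continuous_image[OF that assms] by (rule compact_imp_bounded)
  then show ?thesis
    using type_definition.Rep_range[OF type_definition_bcontfun] by (auto simp: bcontfun_def)
qed

lemma norm_bcontfun_Sup:
  "norm (f :: 'x :: topological_space \<Rightarrow>\<^sub>C 'a :: real_normed_vector) = (SUP x. norm (f x))"
  unfolding norm_bcontfun_def by transfer simp


section \<open>Weak amenability\<close>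

text \<open>\<open>'a \<Rightarrow>\<^sub>L complex\<close> consists of the bounded real-linear functionals. The dual space is
  the subspace of complex-linear ones; its norm is the operator norm inherited from there.\<close>

definition complex_dual :: "('a :: complex_banach_algebra \<Rightarrow>\<^sub>L complex) set"
  where "complex_dual = {\<phi>. \<forall>c x. blinfun_apply \<phi> (c *\<^sub>C x) = c * blinfun_apply \<phi> x}"

text \<open>The module actions on the dual are $(a \cdot \phi)(x) = \phi(xa)$ and
  $(\phi \cdot a)(x) = \phi(ax)$.\<close>

definition dual_left_act ::
    "'a :: complex_banach_algebra \<Rightarrow> ('a \<Rightarrow>\<^sub>L complex) \<Rightarrow> ('a \<Rightarrow>\<^sub>L complex)"
  where "dual_left_act a \<phi> = \<phi> o\<^sub>L blinfun_mult_left a"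

definition dual_right_act ::
    "('a :: complex_banach_algebra \<Rightarrow>\<^sub>L complex) \<Rightarrow> 'a \<Rightarrow> ('a \<Rightarrow>\<^sub>L complex)"
  where "dual_right_act \<phi> a = \<phi> o\<^sub>L blinfun_mult_right a"

lemma dual_act_apply:
  "blinfun_apply (dual_left_act a \<phi>) x = blinfun_apply \<phi> (x * a)"
  "blinfun_apply (dual_right_act \<phi> a) x = blinfun_apply \<phi> (a * x)"
  by (simp_all add: dual_left_act_def dual_right_act_def)

lemma dual_act_closed:
  assumes "\<phi> \<in> complex_dual"
  shows "dual_left_act a \<phi> \<in> complex_dual" "dual_right_act \<phi> a \<in> complex_dual"
  using assms
  by (simp_all add: complex_dual_def dual_act_apply mult_scaleC_left mult_scaleC_right)

text \<open>Continuous complex-linear derivations into the dual. Since \<open>bounded_linear\<close> only covers real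
  scalars, homogeneity over the complex numbers is a separate conjunct.\<close>

definition continuous_dual_derivation ::
    "('a :: complex_banach_algebra \<Rightarrow> ('a \<Rightarrow>\<^sub>L complex)) \<Rightarrow> bool"
  where "continuous_dual_derivation D \<longleftrightarrow>
    bounded_linear D \<and> range D \<subseteq> complex_dual \<and>
    (\<forall>c a x. blinfun_apply (D (c *\<^sub>C a)) x = c * blinfun_apply (D a) x) \<and>
    (\<forall>a b. D (a * b) = dual_left_act a (D b) + dual_right_act (D a) b)"

definition inner_dual_derivation ::
    "('a :: complex_banach_algebra \<Rightarrow> ('a \<Rightarrow>\<^sub>L complex)) \<Rightarrow> bool"
  where "inner_dual_derivation D \<longleftrightarrow>
    (\<exists>\<phi>\<in>complex_dual. \<forall>a. D a = dual_left_act a \<phi> - dual_right_act \<phi> a)"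

definition weakly_amenable :: "'a :: complex_banach_algebra itself \<Rightarrow> bool"
  where "weakly_amenable _ \<longleftrightarrow>
    (\<forall>D :: 'a \<Rightarrow> ('a \<Rightarrow>\<^sub>L complex). continuous_dual_derivation D \<longrightarrow> inner_dual_derivation D)"


section \<open>Bounded approximate identities\<close>

text \<open>As usual in the library, a net is a family with a proper filter on its index type
  (for a directed index set, the filter generated by its tails).\<close>

definition bounded_approximate_identity :: "('i \<Rightarrow> 'a :: real_normed_algebra) \<Rightarrow> 'i filter \<Rightarrow> bool"
  where "bounded_approximate_identity e F \<longleftrightarrow>
    F \<noteq> bot \<and> bounded (range e) \<and>
    (\<forall>a. ((\<lambda>i. e i * a) \<longlongrightarrow> a) F \<and> ((\<lambda>i. a * e i) \<longlongrightarrow> a) F)"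

end

theory Submission
  imports Defs
begin

text \<open>Weak amenability of a commutative algebra means that it has no nonzero continuous derivation
  into its dual, since an inner derivation into a symmetric bimodule vanishes. So let $D$ be a
  continuous derivation from $C(X,A)$ into its dual, and write $h a$ for $x \mapsto h(x) a$.

  The span of the functions $h a$, with $h$ continuous from $X$ to $[0,1]$ and $a \in A$, is dense
  (\<open>bounded_linear_eq_zeroI\<close>), so it suffices that $D(h a)(g b) = 0$. For fixed $g$ the map
  $a \mapsto (b \mapsto D(a)(g b))$, where $a$ and $b$ stand for constant functions, is a continuous
  derivation from $A$ into its dual and hence zero. What is missing is $D(h a) = h D(a)$, which
  expresses that the scalar algebra $C(X)$ carries no derivation.

  Every continuous $h : X \to [-1,1]$ is the mean of two continuous functions of modulus one, namely
  $h \pm i \sqrt{1 - h^2}$, so it suffices to treat multiplication by a function of modulus one. This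
  is a surjective isometry $T$ of $C(X,A)$ with $T(vw) = v\,T(w)$. The defect
  $\delta_T(u) = D(Tu) - D(u) \circ T$ behaves like a derivation in $T$, so that
  $\delta_{T^{n+1}}(u) = (n+1)\,\delta_T(u) \circ T^n$. The left side is bounded uniformly in $n$
  because all powers of $T$ are isometries. As $T^n$ is onto, $\delta_T(u) = 0$
  (\<open>derivation_commutes_isometric_multiplier\<close>). The approximate identity enters in the derivation
  rule for the defect, which needs that $u$ is a limit of products.\<close>

section \<open>Derivations and isometric multipliers\<close>

lemma dual_derivation_mult:
  fixes D :: "'b :: complex_banach_algebra \<Rightarrow> ('b \<Rightarrow>\<^sub>L complex)"
  assumes "continuous_dual_derivation D"
  shows "D (a * b) w = D b (w * a) + D a (b * w)"
  using assms by (simp add: continuous_dual_derivation_def dual_act_apply blinfun.add_left)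

lemma weakly_amenable_comm_iff:
  "weakly_amenable TYPE('b :: {complex_banach_algebra, comm_ring}) \<longleftrightarrow>
    (\<forall>D :: 'b \<Rightarrow> ('b \<Rightarrow>\<^sub>L complex). continuous_dual_derivation D \<longrightarrow> D = (\<lambda>_. 0))"
proof -
  have "inner_dual_derivation D \<longleftrightarrow> D = (\<lambda>_. 0)" for D :: "'b \<Rightarrow> ('b \<Rightarrow>\<^sub>L complex)"
  proof -
    have "dual_left_act a \<phi> - dual_right_act \<phi> a = 0" for a :: 'b and \<phi>
      by (rule blinfun_eqI) (simp add: blinfun.diff_left dual_act_apply mult.commute)
    moreover have "(0 :: 'b \<Rightarrow>\<^sub>L complex) \<in> complex_dual"
      by (simp add: complex_dual_def)
    ultimately show ?thesis
      unfolding inner_dual_derivation_def by auto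
  qed
  then show ?thesis
    by (simp add: weakly_amenable_def)
qed

definition multiplier :: "('b :: real_normed_algebra \<Rightarrow> 'b) \<Rightarrow> bool"
  where "multiplier T \<longleftrightarrow> bounded_linear T \<and> (\<forall>v w. T (v * w) = v * T w)"

lemma multiplier_funpow:
  assumes "multiplier T"
  shows "multiplier (T ^^ n)"
proof (induction n)
  case 0
  then show ?case by (simp add: multiplier_def bounded_linear_ident id_def)
next
  case (Suc n)
  with assms show ?case
    by (simp add: multiplier_def bounded_linear_compose comp_def)
qed

definition derivation_defect ::
    "('b :: real_normed_algebra \<Rightarrow> ('b \<Rightarrow>\<^sub>L complex)) \<Rightarrow> ('b \<Rightarrow> 'b) \<Rightarrow> 'b \<Rightarrow> 'b \<Rightarrow> complex"
  where "derivation_defect D T u w = D (T u) w - D u (T w)"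

text \<open>The terms of the product rule that differentiate \<open>q\<close> cancel, so the defect is a module
  map.\<close>

lemma derivation_defect_mult:
  fixes D :: "'b :: {complex_banach_algebra, comm_ring} \<Rightarrow> ('b \<Rightarrow>\<^sub>L complex)"
  assumes D: "continuous_dual_derivation D" and T: "multiplier T"
  shows "derivation_defect D T (p * q) w = derivation_defect D T p (q * w)"
proof -
  have mult: "T (v * w) = v * T w" for v w
    using T by (simp add: multiplier_def)
  have "D (T (p * q)) w = D (q * T p) w"
    using mult[of q p] by (simp add: mult.commute)
  also have "\<dots> = D (T p) (w * q) + D q (T p * w)"
    by (rule dual_derivation_mult[OF D])
  finally have "D (T (p * q)) w = D (T p) (q * w) + D q (p * T w)"
    using mult[of p w] mult[of w p] by (simp add: mult.commute)
  moreover have "D (p * q) (T w) = D q (p * T w) + D p (T (q * w))"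
    using dual_derivation_mult[OF D, of p q "T w"] mult[of q w] by (simp add: mult.commute)
  ultimately show ?thesis
    by (simp add: derivation_defect_def)
qed

text \<open>If \<open>u\<close> is a product, then \<open>S\<close> can be moved from one factor to the other, and from there to
  \<open>w\<close> by the module property of the defect. The case of a limit of products follows by
  continuity.\<close>

lemma derivation_defect_shift:
  fixes D :: "'b :: {complex_banach_algebra, comm_ring} \<Rightarrow> ('b \<Rightarrow>\<^sub>L complex)"
  assumes D: "continuous_dual_derivation D" and T: "multiplier T" and S: "multiplier S"
    and e: "((\<lambda>i. e i * u) \<longlongrightarrow> u) F" and F: "F \<noteq> bot"
  shows "derivation_defect D T (S u) w = derivation_defect D T u (S w)"
proof -
  have blD: "bounded_linear D" and blT: "bounded_linear T" and blS: "bounded_linear S"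
    using D T S by (auto simp: continuous_dual_derivation_def multiplier_def)
  have lim: "((\<lambda>i. derivation_defect D T (g i) v) \<longlongrightarrow> derivation_defect D T l v) F"
    if "(g \<longlongrightarrow> l) F" for g l v
    unfolding derivation_defect_def
    by (intro tendsto_diff blinfun.tendsto tendsto_const bounded_linear.tendsto[OF blD]
        bounded_linear.tendsto[OF blT] that)
  have "derivation_defect D T (S (e i * u)) w = derivation_defect D T (e i * u) (S w)" for i
  proof -
    have mult: "S (v * w) = v * S w" for v w
      using S by (simp add: multiplier_def)
    have "derivation_defect D T (S (e i * u)) w = derivation_defect D T (u * S (e i)) w"
      using mult[of u "e i"] by (simp add: mult.commute)
    also have "\<dots> = derivation_defect D T u (S (e i) * w)"
      by (rule derivation_defect_mult[OF D T])
    also have "S (e i) * w = e i * S w"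
      using mult[of w "e i"] mult[of "e i" w] by (simp add: mult.commute)
    also have "derivation_defect D T u (e i * S w) = derivation_defect D T (e i * u) (S w)"
      using derivation_defect_mult[OF D T, of u "e i"] by (simp add: mult.commute)
    finally show ?thesis .
  qed
  with lim[OF bounded_linear.tendsto[OF blS e], of w]
  have "((\<lambda>i. derivation_defect D T (e i * u) (S w)) \<longlongrightarrow> derivation_defect D T (S u) w) F"
    by simp
  with lim[OF e, of "S w"] show ?thesis
    using tendsto_unique[OF F] by blast
qed

text \<open>The power rule, as for $d(f^{n+1}) = (n+1) f^n\,df$.\<close>

lemma derivation_defect_funpow:
  fixes D :: "'b :: {complex_banach_algebra, comm_ring} \<Rightarrow> ('b \<Rightarrow>\<^sub>L complex)"
  assumes D: "continuous_dual_derivation D" and T: "multiplier T"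
    and e: "((\<lambda>i. e i * u) \<longlongrightarrow> u) F" and F: "F \<noteq> bot"
  shows "derivation_defect D (T ^^ Suc n) u w = of_nat (Suc n) * derivation_defect D T u ((T ^^ n) w)"
proof (induction n arbitrary: w)
  case 0
  then show ?case by simp
next
  case (Suc n)
  have "derivation_defect D (T ^^ Suc (Suc n)) u w =
      derivation_defect D T ((T ^^ Suc n) u) w + derivation_defect D (T ^^ Suc n) u (T w)"
    by (simp add: derivation_defect_def funpow_swap1)
  also have "\<dots> = derivation_defect D T u ((T ^^ Suc n) w) +
      of_nat (Suc n) * derivation_defect D T u ((T ^^ n) (T w))"
    by (simp only: derivation_defect_shift[OF D T multiplier_funpow[OF T] e F] Suc.IH)
  also have "(T ^^ n) (T w) = (T ^^ Suc n) w"
    by (simp add: funpow_swap1)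
  finally show ?case
    by (simp only: of_nat_Suc distrib_right mult_1_left add.assoc)
qed

text \<open>The defects of the powers of \<open>T\<close> grow linearly by the power rule, but they stay bounded
  because the powers are isometries.\<close>

lemma derivation_commutes_isometric_multiplier:
  fixes D :: "'b :: {complex_banach_algebra, comm_ring} \<Rightarrow> ('b \<Rightarrow>\<^sub>L complex)"
  assumes D: "continuous_dual_derivation D" and T: "multiplier T"
    and isometry: "\<And>v. norm (T v) = norm v" and "surj T"
    and e: "((\<lambda>i. e i * u) \<longlongrightarrow> u) F" and F: "F \<noteq> bot"
  shows "D (T u) w = D u (T w)"
proof -
  have "bounded_linear D"
    using D by (simp add: continuous_dual_derivation_def)
  then obtain K where K: "\<And>v. norm (D v) \<le> norm v * K"
    using bounded_linear.bounded by blast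
  have Dle: "norm (D v z) \<le> norm v * K * norm z" for v z
    using norm_blinfun[of "D v" z] mult_right_mono[OF K[of v] norm_ge_zero[of z]] by linarith
  have iso: "norm ((T ^^ n) v) = norm v" for n v
    by (induction n) (simp_all add: isometry)
  have le: "real (Suc n) * norm (derivation_defect D T u w) \<le> 2 * (norm u * K * norm w)" for n
  proof -
    have "surj (T ^^ n)"
      using \<open>surj T\<close> by simp
    then obtain v where v: "w = (T ^^ n) v"
      by (meson surjE)
    have "real (Suc n) * norm (derivation_defect D T u w) =
        norm (derivation_defect D (T ^^ Suc n) u v)"
      unfolding derivation_defect_funpow[OF D T e F] v by (simp only: norm_mult norm_of_nat)
    also have "\<dots> \<le> norm (D ((T ^^ Suc n) u) v) + norm (D u ((T ^^ Suc n) v))"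
      unfolding derivation_defect_def by (rule norm_triangle_ineq4)
    also have "\<dots> \<le> 2 * (norm u * K * norm v)"
      using Dle[of "(T ^^ Suc n) u" v] Dle[of u "(T ^^ Suc n) v"] unfolding iso by linarith
    finally show ?thesis
      by (simp only: v iso)
  qed
  have "norm (derivation_defect D T u w) = 0"
  proof (rule ccontr)
    assume "norm (derivation_defect D T u w) \<noteq> 0"
    then have "0 < norm (derivation_defect D T u w)" by simp
    then obtain n where "2 * (norm u * K * norm w) < real n * norm (derivation_defect D T u w)"
      using reals_Archimedean3 by blast
    also have "\<dots> \<le> real (Suc n) * norm (derivation_defect D T u w)"
      by (intro mult_right_mono) auto
    finally show False using le[of n] by simp
  qed
  then show ?thesis
    by (simp add: derivation_defect_def)
qed


section \<open>Multiplication by scalar functions\<close>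

lemma scaleC_one: "1 *\<^sub>C x = (x :: 'a :: complex_banach_algebra)"
  using scaleC_of_real[of 1 x] by simp

lemma bounded_bilinear_scaleC:
  "bounded_bilinear (\<lambda>c (x :: 'a :: complex_banach_algebra). c *\<^sub>C x)"
proof
  show "\<exists>K. \<forall>c (x :: 'a). norm (c *\<^sub>C x) \<le> norm c * norm x * K"
    by (rule exI[of _ 1]) (simp add: norm_scaleC)
  show "(r *\<^sub>R c) *\<^sub>C x = r *\<^sub>R (c *\<^sub>C x)" for r c and x :: 'a
    by (simp add: scaleC_of_real[symmetric] scaleC_scaleC scaleR_conv_of_real)
  show "c *\<^sub>C (r *\<^sub>R x) = r *\<^sub>R (c *\<^sub>C x)" for r c and x :: 'a
    by (simp add: scaleC_of_real[symmetric] scaleC_scaleC mult.commute)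
qed (rule scaleC_add_left scaleC_add_right)+

text \<open>The scalar functions are plain functions in the set \<open>bcontfun\<close>, so that they can be
  combined by lambda terms.\<close>

definition scale_fun ::
    "('x \<Rightarrow> complex) \<Rightarrow> ('x :: topological_space \<Rightarrow>\<^sub>C 'a :: complex_banach_algebra) \<Rightarrow> 'x \<Rightarrow>\<^sub>C 'a"
  where "scale_fun f u = Bcontfun (\<lambda>x. f x *\<^sub>C u x)"

lemma scale_fun_apply:
  assumes "f \<in> bcontfun"
  shows "scale_fun f u x = f x *\<^sub>C u x"
proof -
  obtain K where K: "\<And>x. norm (f x) \<le> K"
    using assms unfolding bcontfun_def bounded_iff by auto
  have "continuous_on UNIV (\<lambda>x. f x *\<^sub>C u x)"
    using assms by (intro bounded_bilinear.continuous_on[OF bounded_bilinear_scaleC])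
      (auto simp: bcontfun_def)
  moreover have "norm (f x *\<^sub>C u x) \<le> K * norm u" for x
    unfolding norm_scaleC by (intro mult_mono K norm_bounded order_trans[OF _ K[of x]]) auto
  ultimately have "(\<lambda>x. f x *\<^sub>C u x) \<in> bcontfun"
    by (rule bcontfun_normI)
  then show ?thesis
    by (simp add: scale_fun_def Bcontfun_inverse)
qed

lemma multiplier_scale_fun:
  assumes f: "f \<in> bcontfun"
  shows "multiplier (scale_fun f :: _ \<Rightarrow> 'x :: topological_space \<Rightarrow>\<^sub>C 'a :: complex_banach_algebra)"
  unfolding multiplier_def
proof (intro conjI allI)
  obtain K where K: "\<And>x. norm (f x) \<le> K"
    using f unfolding bcontfun_def bounded_iff by auto
  show "bounded_linear (scale_fun f :: _ \<Rightarrow> 'x \<Rightarrow>\<^sub>C 'a)"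
  proof (rule bounded_linear_intro[where K = K])
    fix u v :: "'x \<Rightarrow>\<^sub>C 'a" and r :: real
    show "scale_fun f (u + v) = scale_fun f u + scale_fun f v"
      by (rule bcontfun_eqI) (simp add: scale_fun_apply[OF f] scaleC_add_right)
    show "scale_fun f (r *\<^sub>R u) = r *\<^sub>R scale_fun f u"
      by (rule bcontfun_eqI)
        (simp add: scale_fun_apply[OF f] bounded_bilinear.scaleR_right[OF bounded_bilinear_scaleC])
    show "norm (scale_fun f u) \<le> norm u * K"
    proof (rule norm_bound)
      fix x
      have "norm (scale_fun f u x) = norm (u x) * norm (f x)"
        by (simp add: scale_fun_apply[OF f] norm_scaleC)
      also have "\<dots> \<le> norm u * K"
        by (intro mult_mono K norm_bounded) auto
      finally show "norm (scale_fun f u x) \<le> norm u * K" .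
    qed
  qed
  show "scale_fun f (v * w) = v * scale_fun f w" for v w :: "'x \<Rightarrow>\<^sub>C 'a"
    by (rule bcontfun_eqI) (simp add: scale_fun_apply[OF f] times_bcontfun.rep_eq mult_scaleC_right)
qed

lemma unimodular_scale_fun:
  assumes cont: "continuous_on UNIV f" and f1: "\<And>x. cmod (f x) = 1"
  shows "f \<in> bcontfun"
    and "norm (scale_fun f u) = norm u"
    and "surj (scale_fun f :: _ \<Rightarrow> 'x :: topological_space \<Rightarrow>\<^sub>C 'a :: complex_banach_algebra)"
proof -
  show f: "f \<in> bcontfun"
    using cont by (rule bcontfun_normI[where b = 1]) (simp add: f1)
  show "norm (scale_fun f u) = norm u"
    by (simp add: norm_bcontfun_Sup scale_fun_apply[OF f] norm_scaleC f1)
  have g: "(\<lambda>x. cnj (f x)) \<in> bcontfun"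
    by (rule bcontfun_normI[where b = 1]) (auto simp: f1 intro!: continuous_intros cont)
  have inv: "f x * cnj (f x) = 1" for x
    by (metis complex_norm_square f1 of_real_1 power_one)
  have "scale_fun f (scale_fun (\<lambda>x. cnj (f x)) v) = v" for v :: "'x \<Rightarrow>\<^sub>C 'a"
    by (rule bcontfun_eqI) (simp add: scale_fun_apply f g scaleC_scaleC inv scaleC_one)
  then show "surj (scale_fun f :: _ \<Rightarrow> 'x \<Rightarrow>\<^sub>C 'a)"
    by (metis surjI)
qed

text \<open>A real function with values in $[-1,1]$ is the mean of the unimodular functions
  $h \pm i \sqrt{1 - h^2}$, both of which give isometric multipliers.\<close>

lemma derivation_scale_fun:
  fixes D :: "('x :: topological_space \<Rightarrow>\<^sub>C 'a :: {complex_banach_algebra, comm_ring}) \<Rightarrow> _"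
  assumes D: "continuous_dual_derivation D"
    and e: "((\<lambda>i. e i * u) \<longlongrightarrow> u) F" and F: "F \<noteq> bot"
    and cont: "continuous_on UNIV h" and h: "\<And>x. \<bar>h x\<bar> \<le> (1 :: real)"
  shows "D (scale_fun (\<lambda>x. of_real (h x)) u) w = D u (scale_fun (\<lambda>x. of_real (h x)) w)"
proof -
  define f where "f s x = Complex (h x) (s * sqrt (1 - (h x)\<^sup>2))" for s x
  have h2: "(h x)\<^sup>2 \<le> 1" for x
    using h[of x] by (simp add: abs_square_le_1)
  have fcont: "continuous_on UNIV (f s)" for s
    unfolding f_def Complex_eq by (intro continuous_intros cont)
  have f1: "cmod (f s x) = 1" if "s\<^sup>2 = 1" for s x
    using that h2[of x] by (simp add: f_def cmod_def power_mult_distrib)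
  note un = unimodular_scale_fun[OF fcont f1]
  have comm: "D (scale_fun (f s) u) w = D u (scale_fun (f s) w)" if s: "s\<^sup>2 = 1" for s
    using derivation_commutes_isometric_multiplier[OF D multiplier_scale_fun un(2) un(3) e F]
      un(1) s by blast
  have hb: "(\<lambda>x. complex_of_real (h x)) \<in> bcontfun"
    by (rule bcontfun_normI[where b = 1]) (auto simp: h intro!: continuous_intros cont)
  have mean: "scale_fun (\<lambda>x. of_real (h x)) v =
      (1/2) *\<^sub>R (scale_fun (f 1) v + scale_fun (f (-1)) v)" for v :: "'x \<Rightarrow>\<^sub>C 'a"
  proof (rule bcontfun_eqI)
    fix x
    have "f 1 x + f (-1) x = complex_of_real 2 * of_real (h x)"
      by (simp add: f_def complex_eq_iff)
    then have "f 1 x *\<^sub>C v x + f (-1) x *\<^sub>C v x = 2 *\<^sub>R (of_real (h x) *\<^sub>C v x)"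
      by (simp only: scaleC_add_left[symmetric] scaleC_of_real[symmetric] scaleC_scaleC)
    then show "scale_fun (\<lambda>x. of_real (h x)) v x =
        ((1/2) *\<^sub>R (scale_fun (f 1) v + scale_fun (f (-1)) v)) x"
      by (simp add: scale_fun_apply hb un(1) plus_bcontfun.rep_eq)
  qed
  have "bounded_linear D"
    using D by (simp add: continuous_dual_derivation_def)
  then have "D (scale_fun (\<lambda>x. of_real (h x)) u) =
      (1/2) *\<^sub>R (D (scale_fun (f 1) u) + D (scale_fun (f (-1)) u))"
    unfolding mean by (simp add: bounded_linear.linear linear_add linear_cmul)
  then show ?thesis
    using comm[of 1] comm[of "-1"] unfolding mean
    by (simp add: blinfun.add_left blinfun.add_right blinfun.scaleR_left blinfun.scaleR_right)
qed


section \<open>Density of the elementary tensors\<close>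

text \<open>Cover the compact range of \<open>u\<close> by finitely many balls of radius $\varepsilon$ with centres in
  \<open>c\<close>. The bumps $\max(0, \varepsilon - \|u(x) - c\|)$, divided by their sum, are a partition of unity
  \<open>h\<close> on \<open>X\<close>, and \<open>u\<close> differs from $\sum_c h_c c$ by at most $\varepsilon$.\<close>

lemma elementary_tensors_dense:
  fixes u :: "'x :: topological_space \<Rightarrow>\<^sub>C 'a :: complex_banach_algebra"
  assumes "compact (UNIV :: 'x set)" and \<epsilon>: "0 < \<epsilon>"
  obtains C :: "'a set" and h :: "'a \<Rightarrow> 'x \<Rightarrow> real"
  where "finite C" "\<And>c. c \<in> C \<Longrightarrow> continuous_on UNIV (h c)"
    "\<And>c x. c \<in> C \<Longrightarrow> h c x \<in> {0..1}"
    "norm (u - (\<Sum>c\<in>C. scale_fun (\<lambda>x. of_real (h c x)) (const_bcontfun c))) \<le> \<epsilon>"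
proof -
  have ucont: "continuous_on UNIV u"
    using apply_bcontfun[of u] by (simp add: bcontfun_def)
  then have "compact (range u)"
    using assms(1) by (rule compact_continuous_image)
  then obtain C where C: "finite C" "range u \<subseteq> (\<Union>c\<in>C. ball c \<epsilon>)"
    using \<epsilon> unfolding compact_eq_totally_bounded by blast
  define g where "g c x = max 0 (\<epsilon> - dist (u x) c)" for c x
  define G where "G x = (\<Sum>c\<in>C. g c x)" for x
  define h where "h c x = g c x / G x" for c x
  have g0: "0 \<le> g c x" for c x by (simp add: g_def)
  have G: "0 < G x" for x
  proof -
    have "u x \<in> (\<Union>c\<in>C. ball c \<epsilon>)" using C(2) by blast
    then obtain c where "c \<in> C" "dist c (u x) < \<epsilon>" by auto
    then show ?thesis
      unfolding G_def by (intro sum_pos2[OF C(1), of c] g0) (auto simp: g_def dist_commute)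
  qed
  have hcont: "continuous_on UNIV (h c)" for c
  proof -
    have "continuous_on UNIV (g c)" for c
      unfolding g_def by (intro continuous_intros ucont)
    moreover from this have "continuous_on UNIV G"
      unfolding G_def by (intro continuous_intros)
    ultimately show ?thesis
      unfolding h_def using G by (intro continuous_intros) (auto simp: less_imp_neq[symmetric])
  qed
  have h01: "h c x \<in> {0..1}" if "c \<in> C" for c x
    using member_le_sum[of c C "\<lambda>c. g c x"] that g0 C(1) G[of x]
    by (simp add: h_def G_def[symmetric])
  have hb: "(\<lambda>x. complex_of_real (h c x)) \<in> bcontfun" if "c \<in> C" for c
    using h01[OF that] by (intro bcontfun_normI[where b = 1]) (auto intro!: continuous_intros hcont)
  have hsum: "(\<Sum>c\<in>C. h c x) = 1" for x
    using G[of x] by (simp add: h_def sum_divide_distrib[symmetric] G_def[symmetric])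
  have apply_sum: "(\<Sum>c\<in>B. v c) x = (\<Sum>c\<in>B. v c x)" for v :: "'a \<Rightarrow> 'x \<Rightarrow>\<^sub>C 'a" and B x
    by (induction B rule: infinite_finite_induct) auto
  have "norm (u - (\<Sum>c\<in>C. scale_fun (\<lambda>x. of_real (h c x)) (const_bcontfun c))) \<le> \<epsilon>"
  proof (rule norm_bound)
    fix x
    have "(u - (\<Sum>c\<in>C. scale_fun (\<lambda>x. of_real (h c x)) (const_bcontfun c))) x =
        u x - (\<Sum>c\<in>C. h c x *\<^sub>R c)"
      by (simp add: apply_sum scale_fun_apply hb scaleC_of_real)
    also have "\<dots> = (\<Sum>c\<in>C. h c x *\<^sub>R (u x - c))"
      by (simp add: scaleR_diff_right sum_subtractf scaleR_sum_left[symmetric] hsum)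
    also have "norm \<dots> \<le> (\<Sum>c\<in>C. h c x * \<epsilon>)"
    proof (rule sum_norm_le)
      fix c assume "c \<in> C"
      \<comment> \<open>The weight of a centre at distance at least \<open>\<epsilon>\<close> from \<open>u x\<close> is zero.\<close>
      show "norm (h c x *\<^sub>R (u x - c)) \<le> h c x * \<epsilon>"
      proof (cases "h c x = 0")
        case False
        then have "dist (u x) c < \<epsilon>"
          by (auto simp: h_def g_def split: if_splits)
        then show ?thesis
          using h01[OF \<open>c \<in> C\<close>, of x] by (simp add: dist_norm mult_left_mono)
      qed simp
    qed
    also have "\<dots> = \<epsilon>"
      by (simp add: sum_distrib_right[symmetric] hsum)
    finally show "norm ((u - (\<Sum>c\<in>C. scale_fun (\<lambda>x. of_real (h c x)) (const_bcontfun c))) x) \<le> \<epsilon>" .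
  qed
  with C(1) hcont h01 show thesis by (rule that)
qed

lemma bounded_linear_eq_zeroI:
  fixes L :: "('x :: topological_space \<Rightarrow>\<^sub>C 'a :: complex_banach_algebra) \<Rightarrow> 'c :: real_normed_vector"
  assumes X: "compact (UNIV :: 'x set)" and L: "bounded_linear L"
    and zero: "\<And>h a. continuous_on UNIV h \<Longrightarrow> (\<And>x. h x \<in> {0..1 :: real}) \<Longrightarrow>
      L (scale_fun (\<lambda>x. of_real (h x)) (const_bcontfun a)) = 0"
  shows "L u = 0"
proof -
  obtain K where K: "0 < K" "\<And>v. norm (L v) \<le> norm v * K"
    using bounded_linear.pos_bounded[OF L] by blast
  have "norm (L u) \<le> \<epsilon>" if "0 < \<epsilon>" for \<epsilon>
  proof -
    have "0 < \<epsilon> / K" using that K(1) by simp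
    then obtain C h where C: "finite C" "\<And>c. c \<in> C \<Longrightarrow> continuous_on UNIV (h c)"
        "\<And>c x. c \<in> C \<Longrightarrow> h c x \<in> {0..1 :: real}"
        "norm (u - (\<Sum>c\<in>C. scale_fun (\<lambda>x. of_real (h c x)) (const_bcontfun c))) \<le> \<epsilon> / K"
      by (rule elementary_tensors_dense[OF X, of "\<epsilon> / K" u]) (rule that)
    have "L (\<Sum>c\<in>C. scale_fun (\<lambda>x. of_real (h c x)) (const_bcontfun c)) = 0"
      using C by (simp add: linear_sum[OF bounded_linear.linear[OF L]] zero)
    then have "L u = L (u - (\<Sum>c\<in>C. scale_fun (\<lambda>x. of_real (h c x)) (const_bcontfun c)))"
      by (simp add: linear_diff[OF bounded_linear.linear[OF L]])
    also have "norm \<dots> \<le> \<epsilon> / K * K"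
      using K(2) mult_right_mono[OF C(4), of K] K(1) by (meson less_imp_le order_trans)
    finally show ?thesis using K(1) by simp
  qed
  then have "norm (L u) \<le> 0"
    by (meson dense_ge)
  then show ?thesis by simp
qed


section \<open>Weak amenability of the function algebra\<close>

lemma bounded_linear_const_bcontfun:
  "bounded_linear (const_bcontfun :: 'a :: real_normed_vector \<Rightarrow> 'x :: topological_space \<Rightarrow>\<^sub>C 'a)"
  by (rule bounded_linear_intro[where K = 1]) (auto intro!: bcontfun_eqI norm_bound)

text \<open>Restricting a derivation to the constants, and its values to a multiple of the constants by a
  scalar function, gives a derivation of \<open>A\<close> into its dual.\<close>

lemma derivation_constants_eq_zero:
  fixes D :: "('x :: topological_space \<Rightarrow>\<^sub>C 'a :: {complex_banach_algebra, comm_ring}) \<Rightarrow> _"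
  assumes D: "continuous_dual_derivation D" and A: "weakly_amenable TYPE('a)"
    and g: "g \<in> bcontfun"
  shows "D (const_bcontfun a) (scale_fun g (const_bcontfun b)) = 0"
proof -
  let ?k = "const_bcontfun :: 'a \<Rightarrow> 'x \<Rightarrow>\<^sub>C 'a"
  have blD: "bounded_linear D" and dual: "\<And>v. D v \<in> complex_dual"
    and homog: "\<And>c v w. D (c *\<^sub>C v) w = c * D v w"
    using D by (auto simp: continuous_dual_derivation_def)
  have bl: "bounded_linear (\<lambda>b. scale_fun g (?k b))"
    using multiplier_scale_fun[OF g] bounded_linear_const_bcontfun
    unfolding multiplier_def by (blast intro: bounded_linear_compose)
  have k_scaleC: "?k (c *\<^sub>C b) = c *\<^sub>C ?k b" for c b
    by (rule bcontfun_eqI) (simp add: scaleC_bcontfun.rep_eq)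
  have k_mult: "?k (a * b) = ?k a * ?k b" for a b
    by (rule bcontfun_eqI) (simp add: times_bcontfun.rep_eq)
  have g_scaleC: "scale_fun g (c *\<^sub>C v) = c *\<^sub>C scale_fun g v" for c and v :: "'x \<Rightarrow>\<^sub>C 'a"
    by (rule bcontfun_eqI)
      (simp add: scale_fun_apply[OF g] scaleC_bcontfun.rep_eq scaleC_scaleC mult.commute)
  have g_mult: "scale_fun g (v * w) = v * scale_fun g w" for v w :: "'x \<Rightarrow>\<^sub>C 'a"
    using multiplier_scale_fun[OF g] unfolding multiplier_def by blast
  define E where "E a = D (?k a) o\<^sub>L Blinfun (\<lambda>b. scale_fun g (?k b))" for a
  have E: "E a b = D (?k a) (scale_fun g (?k b))" for a b
    by (simp add: E_def bounded_linear_Blinfun_apply[OF bl])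
  have "continuous_dual_derivation E"
    unfolding continuous_dual_derivation_def
  proof (intro conjI allI)
    show "bounded_linear E"
      unfolding E_def
      by (intro bounded_linear_compose[OF bounded_bilinear.bounded_linear_left
          [OF bounded_bilinear_blinfun_compose]] bounded_linear_compose[OF blD]
          bounded_linear_const_bcontfun)
    show "range E \<subseteq> complex_dual"
      using dual by (auto simp: complex_dual_def E k_scaleC g_scaleC)
    show "E (c *\<^sub>C a) x = c * E a x" for c a x
      by (simp add: E k_scaleC homog)
    show "E (a * b) = dual_left_act a (E b) + dual_right_act (E a) b" for a b
    proof (rule blinfun_eqI)
      fix x
      have "scale_fun g (?k (x * a)) = scale_fun g (?k x) * ?k a"
        using g_mult[of "?k a" "?k x"] by (simp add: k_mult mult.commute)
      moreover have "scale_fun g (?k (b * x)) = ?k b * scale_fun g (?k x)"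
        by (simp add: k_mult g_mult)
      ultimately show "E (a * b) x = (dual_left_act a (E b) + dual_right_act (E a) b) x"
        by (simp add: E blinfun.add_left dual_act_apply k_mult[of a b] dual_derivation_mult[OF D])
    qed
  qed
  then have "E = (\<lambda>_. 0)"
    using A unfolding weakly_amenable_comm_iff by blast
  then show ?thesis
    using E[of a b] by simp
qed

theorem proposition4p1:
  fixes e :: "'i \<Rightarrow> 'a :: {complex_banach_algebra, comm_ring}"
    and F :: "'i filter"
  assumes "compact (UNIV :: 'x :: t2_space set)"
    and "weakly_amenable TYPE('a)"
    and "bounded_approximate_identity e F"
  shows "weakly_amenable TYPE('x \<Rightarrow>\<^sub>C 'a)"
  unfolding weakly_amenable_comm_iff
proof (intro allI impI ext)
  fix D :: "('x \<Rightarrow>\<^sub>C 'a) \<Rightarrow> ('x \<Rightarrow>\<^sub>C 'a) \<Rightarrow>\<^sub>L complex" and u :: "'x \<Rightarrow>\<^sub>C 'a"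
  assume D: "continuous_dual_derivation D"
  let ?k = "const_bcontfun :: 'a \<Rightarrow> 'x \<Rightarrow>\<^sub>C 'a"
  have F: "F \<noteq> bot" and e: "\<And>a. ((\<lambda>i. e i * a) \<longlongrightarrow> a) F"
    using assms(3) by (auto simp: bounded_approximate_identity_def)
  have ke: "((\<lambda>i. ?k (e i) * ?k a) \<longlongrightarrow> ?k a) F" for a
  proof -
    have "?k (e i) * ?k a = ?k (e i * a)" for i
      by (rule bcontfun_eqI) (simp add: times_bcontfun.rep_eq)
    then show ?thesis
      using bounded_linear.tendsto[OF bounded_linear_const_bcontfun e] by simp
  qed
  have const: "D (?k a) w = 0" for a w
    by (rule bounded_linear_eq_zeroI[OF assms(1) blinfun.bounded_linear_right])
      (auto intro!: derivation_constants_eq_zero[OF D assms(2)] bcontfun_normI[where b = 1]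
        continuous_intros)
  have "bounded_linear D"
    using D by (simp add: continuous_dual_derivation_def)
  with assms(1) show "D u = 0"
  proof (rule bounded_linear_eq_zeroI)
    fix h :: "'x \<Rightarrow> real" and a
    assume "continuous_on UNIV h" "\<And>x. h x \<in> {0..1}"
    then show "D (scale_fun (\<lambda>x. of_real (h x)) (?k a)) = 0"
      by (intro blinfun_eqI) (simp add: derivation_scale_fun[OF D ke F] const)
  qed
qed

end
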